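(* Let $(x_1,x_2,x_3)\in\mathbb{R}^3$ with $(x_1,x_2,x_3)\ne(0,0,0)$. Then: (i) $(x_1+x_2+x_3)^4\ge 8(x_1^3x_2+x_1x_3^3+x_2^3x_3)+19x_1x_2x_3(x_1+x_2+x_3)$, with equality if and only if $x_1=x_2=x_3$; (ii) $(x_1+x_2+x_3)^4> 8(x_1^3x_2+x_1x_3^3+x_2^3x_3)+14x_1x_2x_3(x_1+x_2+x_3)$; (iii) $(x_1+x_2+x_3)^4> 8(x_1^3x_2+x_1x_3^3+x_2^3x_3)+15x_1x_2x_3(x_1+x_2+x_3)$; (iv) $(x_1+x_2+x_3)^4> 8(x_1^3x_2+x_1x_3^3+x_2^3x_3)+16x_1x_2x_3(x_1+x_2+x_3)$; (v) $(x_1+x_2+x_3)^4> 8(x_1^3x_2+x_1x_3^3+x_2^3x_3)+17x_1x_2x_3(x_1+x_2+x_3)$; (vi) $(x_1+x_2+x_3)^4> 8(x_1^3x_2+x_1x_3^3+x_2^3x_3)+18x_1x_2x_3(x_1+x_2+x_3)$. Furthermore, all these (strict) inequalities still hold if, in each of them, the expression $x_1^3x_2+x_1x_3^3+x_2^3x_3$ is replaced by $x_1x_2^3+x_1^3x_3+x_2x_3^3$. *)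

theory Defs
  imports Complex_Main
begin

end

theory Submission
  imports Defs
begin

text \<open>
  Write \<open>f\<^sub>c\<close> for the difference of the two sides when the coefficient of
  \<open>x y z (x + y + z)\<close> is \<open>c\<close>. In the pencil \<open>f\<^sub>c\<close>, every member between \<open>c = 14\<close> and
  \<open>c = 19\<close> is a convex combination of the two endpoint forms, so everything reduces to those two.
  With \<open>D x y z = 3 (x\<^sup>2 - y\<^sup>2) - 8 x y + 4 y z + 4 z x\<close>, both endpoints are sums of squares with a
  common part:
  \<open>18 f\<^sub>1\<^sub>9\<close> is the cyclic sum of \<open>D\<^sup>2 + 15 (x y - y z)\<^sup>2\<close>, while
  \<open>18 f\<^sub>1\<^sub>4\<close> is the cyclic sum of \<open>D\<^sup>2\<close> plus \<open>30 (x y + y z + z x)\<^sup>2\<close>.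
  The first representation vanishes only when \<open>x = y = z\<close>; the second one vanishes only at the
  origin, because its quadrics have no common real projective point.

  The shape of \<open>D\<close> comes from matching coefficients: in half the cyclic sum of
  \<open>(x\<^sup>2 - y\<^sup>2 + a x y + b y z + c z x)\<^sup>2\<close> with \<open>a + b + c = 0\<close>, the choice \<open>a = -8/3\<close>,
  \<open>b = c = 4/3\<close> produces exactly the terms \<open>x\<^sup>4\<close>, \<open>x\<^sup>3 y\<close>, \<open>x y\<^sup>3\<close> of \<open>f\<^sub>c\<close>. What is left
  is a combination of the cyclic sums of \<open>x\<^sup>2 y\<^sup>2\<close> and \<open>x\<^sup>2 y z\<close>, and it is a nonnegative
  quadratic form in \<open>x y, y z, z x\<close> precisely for \<open>14 \<le> c \<le> 19\<close>.
  The inequalities for the reversed cyclic sum follow by exchanging the second and third variables.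
\<close>

definition quartic_gap :: "real \<Rightarrow> real \<Rightarrow> real \<Rightarrow> real \<Rightarrow> real" where
  "quartic_gap c x y z =
     (x + y + z) ^ 4 - (8 * (x ^ 3 * y + x * z ^ 3 + y ^ 3 * z) + c * x * y * z * (x + y + z))"

definition cyclic_quadric :: "real \<Rightarrow> real \<Rightarrow> real \<Rightarrow> real" where
  "cyclic_quadric x y z = 3 * (x\<^sup>2 - y\<^sup>2) - 8 * x * y + 4 * y * z + 4 * z * x"

lemma quartic_gap_19_sum_of_squares:
  "18 * quartic_gap 19 x y z =
     (cyclic_quadric x y z)\<^sup>2 + (cyclic_quadric y z x)\<^sup>2 + (cyclic_quadric z x y)\<^sup>2
     + 15 * ((x * y - y * z)\<^sup>2 + (y * z - z * x)\<^sup>2 + (z * x - x * y)\<^sup>2)"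
  unfolding quartic_gap_def cyclic_quadric_def by algebra

lemma quartic_gap_14_sum_of_squares:
  "18 * quartic_gap 14 x y z =
     (cyclic_quadric x y z)\<^sup>2 + (cyclic_quadric y z x)\<^sup>2 + (cyclic_quadric z x y)\<^sup>2
     + 30 * (x * y + y * z + z * x)\<^sup>2"
  unfolding quartic_gap_def cyclic_quadric_def by algebra

lemma quartic_gap_19_nonneg: "quartic_gap 19 x y z \<ge> 0"
proof -
  have "18 * quartic_gap 19 x y z \<ge> 0"
    unfolding quartic_gap_19_sum_of_squares by (intro add_nonneg_nonneg mult_nonneg_nonneg) auto
  then show ?thesis by simp
qed

lemma quartic_gap_14_nonneg: "quartic_gap 14 x y z \<ge> 0"
proof -
  have "18 * quartic_gap 14 x y z \<ge> 0"
    unfolding quartic_gap_14_sum_of_squares by (intro add_nonneg_nonneg mult_nonneg_nonneg) auto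
  then show ?thesis by simp
qed

text \<open>
  Once the products \<open>x y\<close>, \<open>y z\<close>, \<open>z x\<close> agree, the mixed terms of the quadrics cancel
  and vanishing of the quadrics forces \<open>x\<^sup>2 = y\<^sup>2 = z\<^sup>2\<close>; the agreement of the products then also
  excludes differing signs.
\<close>

lemma quartic_gap_19_eq_0_iff: "quartic_gap 19 x y z = 0 \<longleftrightarrow> x = y \<and> y = z"
proof
  assume "quartic_gap 19 x y z = 0"
  then have sos: "(cyclic_quadric x y z)\<^sup>2 + (cyclic_quadric y z x)\<^sup>2 + (cyclic_quadric z x y)\<^sup>2
     + 15 * ((x * y - y * z)\<^sup>2 + (y * z - z * x)\<^sup>2 + (z * x - x * y)\<^sup>2) = 0"
    using quartic_gap_19_sum_of_squares[of x y z] by simp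
  then have products: "x * y = y * z" "y * z = z * x"
    and quadrics: "cyclic_quadric x y z = 0" "cyclic_quadric y z x = 0"
    by (simp_all add: add_nonneg_eq_0_iff)
  have squares: "x\<^sup>2 = y\<^sup>2" "y\<^sup>2 = z\<^sup>2"
    using products quadrics unfolding cyclic_quadric_def by algebra+
  have "(x - y)\<^sup>2 * x\<^sup>2 = 0" "(y - z)\<^sup>2 * x\<^sup>2 = 0"
    using products squares by algebra+
  then show "x = y \<and> y = z"
    using squares by auto
next
  assume "x = y \<and> y = z"
  then show "quartic_gap 19 x y z = 0"
    by (simp add: quartic_gap_def power4_eq_xxxx power3_eq_cube)
qed

text \<open>
  On the conic \<open>x y + y z + z x = 0\<close> the vanishing quadrics become \<open>x\<^sup>2 - y\<^sup>2 = 4 x y\<close> and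
  \<open>y\<^sup>2 - z\<^sup>2 = 4 y z\<close>. Eliminating \<open>z\<close> through \<open>z (x + y) = - x y\<close> leaves binary quadratics
  in \<open>x, y\<close> that share no root unless \<open>y = 0\<close>, and then everything vanishes.
\<close>

lemma quartic_gap_14_eq_0_imp:
  assumes "quartic_gap 14 x y z = 0"
  shows "x = 0 \<and> y = 0 \<and> z = 0"
proof -
  have sos: "(cyclic_quadric x y z)\<^sup>2 + (cyclic_quadric y z x)\<^sup>2 + (cyclic_quadric z x y)\<^sup>2
     + 30 * (x * y + y * z + z * x)\<^sup>2 = 0"
    using assms quartic_gap_14_sum_of_squares[of x y z] by simp
  then have conic: "x * y + y * z + z * x = 0"
    and quadrics: "cyclic_quadric x y z = 0" "cyclic_quadric y z x = 0"
    by (simp_all add: add_nonneg_eq_0_iff)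
  have xy: "x\<^sup>2 - y\<^sup>2 = 4 * x * y" and yz: "y\<^sup>2 - z\<^sup>2 = 4 * y * z"
    using conic quadrics unfolding cyclic_quadric_def by algebra+
  have y0: "y = 0"
  proof (rule ccontr)
    assume y: "y \<noteq> 0"
    have "y\<^sup>2 * (4 * x\<^sup>2 + 6 * x * y + y\<^sup>2) = 0"
      using conic yz by algebra
    then have "4 * x\<^sup>2 + 6 * x * y + y\<^sup>2 = 0"
      using y by simp
    \<comment> \<open>Subtracting four times the relation between \<open>x\<close> and \<open>y\<close> makes the equation linear in \<open>x\<close>.\<close>
    then have "y * (22 * x + 5 * y) = 0"
      using xy by algebra
    then have "22 * x + 5 * y = 0"
      using y by simp
    then have "y\<^sup>2 = 0"
      using xy by algebra
    then show False
      using y by simp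
  qed
  show ?thesis
    using xy yz y0 by simp
qed

lemma quartic_gap_pos:
  assumes "14 \<le> c" "c < 19" "(x, y, z) \<noteq> (0, 0, 0)"
  shows "quartic_gap c x y z > 0"
proof -
  have interpolate:
    "5 * quartic_gap c x y z = (19 - c) * quartic_gap 14 x y z + (c - 14) * quartic_gap 19 x y z"
    unfolding quartic_gap_def by algebra
  have "quartic_gap 14 x y z > 0"
    using assms(3) quartic_gap_14_eq_0_imp[of x y z] quartic_gap_14_nonneg[of x y z] by force
  then have "(19 - c) * quartic_gap 14 x y z > 0"
    using assms(2) by simp
  moreover have "(c - 14) * quartic_gap 19 x y z \<ge> 0"
    using assms(1) quartic_gap_19_nonneg by simp
  ultimately show ?thesis
    using interpolate by linarith
qed

theorem corollary4p7:
  fixes x\<^sub>1 x\<^sub>2 x\<^sub>3 :: real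
  assumes "(x\<^sub>1, x\<^sub>2, x\<^sub>3) \<noteq> (0, 0, 0)"
  shows "(x\<^sub>1 + x\<^sub>2 + x\<^sub>3) ^ 4 \<ge> 8 * (x\<^sub>1 ^ 3 * x\<^sub>2 + x\<^sub>1 * x\<^sub>3 ^ 3 + x\<^sub>2 ^ 3 * x\<^sub>3) + 19 * x\<^sub>1 * x\<^sub>2 * x\<^sub>3 * (x\<^sub>1 + x\<^sub>2 + x\<^sub>3) \<and>
      ((x\<^sub>1 + x\<^sub>2 + x\<^sub>3) ^ 4 = 8 * (x\<^sub>1 ^ 3 * x\<^sub>2 + x\<^sub>1 * x\<^sub>3 ^ 3 + x\<^sub>2 ^ 3 * x\<^sub>3) + 19 * x\<^sub>1 * x\<^sub>2 * x\<^sub>3 * (x\<^sub>1 + x\<^sub>2 + x\<^sub>3)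
        \<longleftrightarrow> x\<^sub>1 = x\<^sub>2 \<and> x\<^sub>2 = x\<^sub>3) \<and>
      (x\<^sub>1 + x\<^sub>2 + x\<^sub>3) ^ 4 > 8 * (x\<^sub>1 ^ 3 * x\<^sub>2 + x\<^sub>1 * x\<^sub>3 ^ 3 + x\<^sub>2 ^ 3 * x\<^sub>3) + 14 * x\<^sub>1 * x\<^sub>2 * x\<^sub>3 * (x\<^sub>1 + x\<^sub>2 + x\<^sub>3) \<and>
      (x\<^sub>1 + x\<^sub>2 + x\<^sub>3) ^ 4 > 8 * (x\<^sub>1 ^ 3 * x\<^sub>2 + x\<^sub>1 * x\<^sub>3 ^ 3 + x\<^sub>2 ^ 3 * x\<^sub>3) + 15 * x\<^sub>1 * x\<^sub>2 * x\<^sub>3 * (x\<^sub>1 + x\<^sub>2 + x\<^sub>3) \<and>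
      (x\<^sub>1 + x\<^sub>2 + x\<^sub>3) ^ 4 > 8 * (x\<^sub>1 ^ 3 * x\<^sub>2 + x\<^sub>1 * x\<^sub>3 ^ 3 + x\<^sub>2 ^ 3 * x\<^sub>3) + 16 * x\<^sub>1 * x\<^sub>2 * x\<^sub>3 * (x\<^sub>1 + x\<^sub>2 + x\<^sub>3) \<and>
      (x\<^sub>1 + x\<^sub>2 + x\<^sub>3) ^ 4 > 8 * (x\<^sub>1 ^ 3 * x\<^sub>2 + x\<^sub>1 * x\<^sub>3 ^ 3 + x\<^sub>2 ^ 3 * x\<^sub>3) + 17 * x\<^sub>1 * x\<^sub>2 * x\<^sub>3 * (x\<^sub>1 + x\<^sub>2 + x\<^sub>3) \<and>
      (x\<^sub>1 + x\<^sub>2 + x\<^sub>3) ^ 4 > 8 * (x\<^sub>1 ^ 3 * x\<^sub>2 + x\<^sub>1 * x\<^sub>3 ^ 3 + x\<^sub>2 ^ 3 * x\<^sub>3) + 18 * x\<^sub>1 * x\<^sub>2 * x\<^sub>3 * (x\<^sub>1 + x\<^sub>2 + x\<^sub>3) \<and>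
      (x\<^sub>1 + x\<^sub>2 + x\<^sub>3) ^ 4 \<ge> 8 * (x\<^sub>1 * x\<^sub>2 ^ 3 + x\<^sub>1 ^ 3 * x\<^sub>3 + x\<^sub>2 * x\<^sub>3 ^ 3) + 19 * x\<^sub>1 * x\<^sub>2 * x\<^sub>3 * (x\<^sub>1 + x\<^sub>2 + x\<^sub>3) \<and>
      ((x\<^sub>1 + x\<^sub>2 + x\<^sub>3) ^ 4 = 8 * (x\<^sub>1 * x\<^sub>2 ^ 3 + x\<^sub>1 ^ 3 * x\<^sub>3 + x\<^sub>2 * x\<^sub>3 ^ 3) + 19 * x\<^sub>1 * x\<^sub>2 * x\<^sub>3 * (x\<^sub>1 + x\<^sub>2 + x\<^sub>3)
        \<longleftrightarrow> x\<^sub>1 = x\<^sub>2 \<and> x\<^sub>2 = x\<^sub>3) \<and>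
      (x\<^sub>1 + x\<^sub>2 + x\<^sub>3) ^ 4 > 8 * (x\<^sub>1 * x\<^sub>2 ^ 3 + x\<^sub>1 ^ 3 * x\<^sub>3 + x\<^sub>2 * x\<^sub>3 ^ 3) + 14 * x\<^sub>1 * x\<^sub>2 * x\<^sub>3 * (x\<^sub>1 + x\<^sub>2 + x\<^sub>3) \<and>
      (x\<^sub>1 + x\<^sub>2 + x\<^sub>3) ^ 4 > 8 * (x\<^sub>1 * x\<^sub>2 ^ 3 + x\<^sub>1 ^ 3 * x\<^sub>3 + x\<^sub>2 * x\<^sub>3 ^ 3) + 15 * x\<^sub>1 * x\<^sub>2 * x\<^sub>3 * (x\<^sub>1 + x\<^sub>2 + x\<^sub>3) \<and>
      (x\<^sub>1 + x\<^sub>2 + x\<^sub>3) ^ 4 > 8 * (x\<^sub>1 * x\<^sub>2 ^ 3 + x\<^sub>1 ^ 3 * x\<^sub>3 + x\<^sub>2 * x\<^sub>3 ^ 3) + 16 * x\<^sub>1 * x\<^sub>2 * x\<^sub>3 * (x\<^sub>1 + x\<^sub>2 + x\<^sub>3) \<and>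
      (x\<^sub>1 + x\<^sub>2 + x\<^sub>3) ^ 4 > 8 * (x\<^sub>1 * x\<^sub>2 ^ 3 + x\<^sub>1 ^ 3 * x\<^sub>3 + x\<^sub>2 * x\<^sub>3 ^ 3) + 17 * x\<^sub>1 * x\<^sub>2 * x\<^sub>3 * (x\<^sub>1 + x\<^sub>2 + x\<^sub>3) \<and>
      (x\<^sub>1 + x\<^sub>2 + x\<^sub>3) ^ 4 > 8 * (x\<^sub>1 * x\<^sub>2 ^ 3 + x\<^sub>1 ^ 3 * x\<^sub>3 + x\<^sub>2 * x\<^sub>3 ^ 3) + 18 * x\<^sub>1 * x\<^sub>2 * x\<^sub>3 * (x\<^sub>1 + x\<^sub>2 + x\<^sub>3)"
proof -
  have nonzero: "(x\<^sub>1, x\<^sub>3, x\<^sub>2) \<noteq> (0, 0, 0)"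
    using assms by auto
  have reversed: "quartic_gap c x\<^sub>1 x\<^sub>3 x\<^sub>2 =
      (x\<^sub>1 + x\<^sub>2 + x\<^sub>3) ^ 4 - (8 * (x\<^sub>1 * x\<^sub>2 ^ 3 + x\<^sub>1 ^ 3 * x\<^sub>3 + x\<^sub>2 * x\<^sub>3 ^ 3)
        + c * x\<^sub>1 * x\<^sub>2 * x\<^sub>3 * (x\<^sub>1 + x\<^sub>2 + x\<^sub>3))" for c
    unfolding quartic_gap_def by algebra
  have forward: "quartic_gap c x\<^sub>1 x\<^sub>2 x\<^sub>3 =
      (x\<^sub>1 + x\<^sub>2 + x\<^sub>3) ^ 4 - (8 * (x\<^sub>1 ^ 3 * x\<^sub>2 + x\<^sub>1 * x\<^sub>3 ^ 3 + x\<^sub>2 ^ 3 * x\<^sub>3)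
        + c * x\<^sub>1 * x\<^sub>2 * x\<^sub>3 * (x\<^sub>1 + x\<^sub>2 + x\<^sub>3))" for c
    by (rule quartic_gap_def)
  show ?thesis
    using quartic_gap_19_nonneg[of x\<^sub>1 x\<^sub>2 x\<^sub>3] quartic_gap_19_nonneg[of x\<^sub>1 x\<^sub>3 x\<^sub>2]
      quartic_gap_19_eq_0_iff[of x\<^sub>1 x\<^sub>2 x\<^sub>3] quartic_gap_19_eq_0_iff[of x\<^sub>1 x\<^sub>3 x\<^sub>2]
      quartic_gap_pos[OF _ _ assms, of 14] quartic_gap_pos[OF _ _ nonzero, of 14]
      quartic_gap_pos[OF _ _ assms, of 15] quartic_gap_pos[OF _ _ nonzero, of 15]
      quartic_gap_pos[OF _ _ assms, of 16] quartic_gap_pos[OF _ _ nonzero, of 16]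
      quartic_gap_pos[OF _ _ assms, of 17] quartic_gap_pos[OF _ _ nonzero, of 17]
      quartic_gap_pos[OF _ _ assms, of 18] quartic_gap_pos[OF _ _ nonzero, of 18]
    unfolding forward reversed
    by (intro conjI) (simp_all only: diff_gt_0_iff_gt diff_ge_0_iff_ge, auto)
qed

end
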